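(* Let $m,n\ge 0$ be integers. If $\min\{m,n\}\le 1$ or $m+n\le 7$, then $A^\vee_m\oplus A^\vee_n$ is a CL-polytope.
   Context: $A_d=\mathrm{conv}(\{\pm(e_i+e_{i+1}+\dots+e_j):1\le i\le j\le d\})\subset\mathbb{R}^d$ for $d\ge1$, and $A_0^\vee$ denotes the one-point polytope $\{0\}\subset\mathbb{R}^0$ (so $A_0^\vee\oplus Q=Q$). $Q^\vee=\{x:\langle x,y\rangle\ge -1\ \forall y\in Q\}$ is the polar dual. For polytopes $Q_1\subset\mathbb{R}^{d_1},Q_2\subset\mathbb{R}^{d_2}$ containing the origin, $Q_1\oplus Q_2=\mathrm{conv}((Q_1\times\{0\})\cup(\{0\}\times Q_2))\subset\mathbb{R}^{d_1+d_2}$. For an integral full-dimensional polytope $Q\subset\mathbb{R}^d$, $E_Q(k)=\#(kQ\cap\mathbb{Z}^d)$ is its Ehrhart polynomial. A reflexive polytope is CL if all roots of its Ehrhart polynomial lie on the line $\mathrm{Re}(z)=-\tfrac12$ in $\mathbb{C}$. *)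

theory Defs
  imports "HOL-Analysis.Analysis" "HOL-Analysis.Finite_Function_Topology" "HOL-Computational_Algebra.Polynomial"
begin

text \<open>
  Since dimensions (including \<open>0\<close>) have to vary, \<open>\<real>\<^sup>d\<close> is the subspace \<open>Rn d\<close> of vectors supported
  on \<open>{1..d}\<close> inside the normed space of all finitely supported real sequences. Its norm is the
  \<open>\<ell>\<^sup>1\<close> norm, which on \<open>Rn d\<close> induces the usual topology.
\<close>

type_synonym rvec = "nat \<Rightarrow>\<^sub>0 real"

definition Rn :: "nat \<Rightarrow> rvec set" where
  "Rn d = {x. Poly_Mapping.keys x \<subseteq> {1..d}}"

definition Zn :: "nat \<Rightarrow> rvec set" where
  "Zn d = {x \<in> Rn d. \<forall>i. Poly_Mapping.lookup x i \<in> \<int>}"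

definition unit_vec :: "nat \<Rightarrow> rvec" where
  "unit_vec i = Poly_Mapping.single i 1"

definition dot :: "nat \<Rightarrow> rvec \<Rightarrow> rvec \<Rightarrow> real" where
  "dot d x y = (\<Sum>i=1..d. Poly_Mapping.lookup x i * Poly_Mapping.lookup y i)"

definition polar :: "nat \<Rightarrow> rvec set \<Rightarrow> rvec set" where
  "polar d Q = {x \<in> Rn d. \<forall>y\<in>Q. dot d x y \<ge> -1}"

text \<open>The pair \<open>(x, y) \<in> \<real>\<^sup>m \<times> \<real>\<^sup>n = \<real>\<^sup>m\<^sup>+\<^sup>n\<close>, for \<open>x \<in> Rn m\<close> and \<open>y \<in> Rn n\<close>.\<close>

definition vpair :: "nat \<Rightarrow> rvec \<Rightarrow> rvec \<Rightarrow> rvec" where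
  "vpair m x y = x + (\<Sum>i\<in>Poly_Mapping.keys y. Poly_Mapping.single (m + i) (Poly_Mapping.lookup y i))"

text \<open>Only the dimension \<open>m\<close> of the ambient space of the first summand is needed.\<close>

definition free_sum :: "nat \<Rightarrow> rvec set \<Rightarrow> rvec set \<Rightarrow> rvec set" where
  "free_sum m P Q = convex hull ((\<lambda>x. vpair m x 0) ` P \<union> (\<lambda>y. vpair m 0 y) ` Q)"

definition A_polytope :: "nat \<Rightarrow> rvec set" where
  "A_polytope d = convex hull
     (\<Union>i\<in>{1..d}. \<Union>j\<in>{i..d}. {\<Sum>k=i..j. unit_vec k, - (\<Sum>k=i..j. unit_vec k)})"

definition A_dual :: "nat \<Rightarrow> rvec set" where
  "A_dual d = (if d = 0 then {0} else polar d (A_polytope d))"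

definition integral_polytope :: "nat \<Rightarrow> rvec set \<Rightarrow> bool" where
  "integral_polytope d Q \<longleftrightarrow> (\<exists>V. finite V \<and> V \<subseteq> Zn d \<and> Q = convex hull V)"

text \<open>The interior condition makes a reflexive polytope full-dimensional.\<close>

definition reflexive_polytope :: "nat \<Rightarrow> rvec set \<Rightarrow> bool" where
  "reflexive_polytope d Q \<longleftrightarrow>
     integral_polytope d Q \<and> 0 \<in> top_of_set (Rn d) interior_of Q \<and> integral_polytope d (polar d Q)"

text \<open>A polynomial with this property is unique, so the existential quantifier in \<open>CL_polytope\<close>
  below picks out the Ehrhart polynomial.\<close>

definition is_ehrhart_poly :: "nat \<Rightarrow> rvec set \<Rightarrow> complex poly \<Rightarrow> bool" where
  "is_ehrhart_poly d Q p \<longleftrightarrow>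
     (\<forall>k::nat. poly p (of_nat k) = of_nat (card ((\<lambda>x. real k *\<^sub>R x) ` Q \<inter> Zn d)))"

lemma is_ehrhart_poly_unique:
  assumes "is_ehrhart_poly d Q p" and "is_ehrhart_poly d Q q"
  shows "p = q"
proof (rule ccontr)
  assume "p \<noteq> q"
  then have "finite {z. poly (p - q) z = 0}"
    using poly_roots_finite[of "p - q"] by simp
  moreover have "range (of_nat :: nat \<Rightarrow> complex) \<subseteq> {z. poly (p - q) z = 0}"
    using assms by (auto simp: is_ehrhart_poly_def)
  moreover have "infinite (range (of_nat :: nat \<Rightarrow> complex))"
    using finite_imageD inj_of_nat infinite_UNIV_nat by blast
  ultimately show False
    using finite_subset by blast
qed

definition CL_polytope :: "nat \<Rightarrow> rvec set \<Rightarrow> bool" where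
  "CL_polytope d Q \<longleftrightarrow> reflexive_polytope d Q \<and>
     (\<exists>p. is_ehrhart_poly d Q p \<and> (\<forall>z. poly p z = 0 \<longrightarrow> Re z = - 1 / 2))"

end

theory Submission
  imports Defs
begin

text \<open>
  In terms of the partial sums \<open>s\<^sub>0 = 0, s\<^sub>1, \<dots>, s\<^sub>d\<close> of \<open>x\<close>, the polytope \<open>A\<^sub>d\<^sup>\<or>\<close> is the set of all \<open>x\<close> with
  \<open>s\<^sub>j - s\<^sub>i \<le> 1\<close>; it is the image of the cube \<open>[0,1]\<^sup>d\<^sup>+\<^sup>1\<close> under \<open>t \<mapsto> (t\<^sub>i - t\<^sub>i\<^sub>-\<^sub>1)\<^sub>i\<close>. Hence it is integral, and
  normalising the least \<open>t\<^sub>i\<close> to \<open>0\<close> shows that its \<open>k\<close>-th dilate has \<open>(k+1)\<^sup>d\<^sup>+\<^sup>1 - k\<^sup>d\<^sup>+\<^sup>1\<close> lattice points.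
  A lattice point of \<open>k(A\<^sub>m\<^sup>\<or> \<oplus> A\<^sub>n\<^sup>\<or>)\<close> is a pair of lattice points of \<open>aA\<^sub>m\<^sup>\<or>\<close> and \<open>bA\<^sub>n\<^sup>\<or>\<close> for natural numbers
  \<open>a + b \<le> k\<close>, so the Ehrhart polynomial of the free sum is a convolution. For \<open>n \<le> 1\<close> it is
  \<open>(z+1)\<^sup>m\<^sup>+\<^sup>1 \<mp> z\<^sup>m\<^sup>+\<^sup>1\<close>, whose roots satisfy \<open>|z+1| = |z|\<close>. In the six remaining cases it is, with
  \<open>u = z + 1/2\<close>, a polynomial of degree at most \<open>3\<close> in \<open>u\<^sup>2\<close> (times \<open>u\<close> in odd dimension) that has only
  negative real roots because it changes sign often enough.
\<close>

subsection \<open>The dual polytope in partial-sum coordinates\<close>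

abbreviation lookup where "lookup \<equiv> Poly_Mapping.lookup"
abbreviation single where "single \<equiv> Poly_Mapping.single"

definition vec_of :: "nat \<Rightarrow> (nat \<Rightarrow> real) \<Rightarrow> rvec" where
  "vec_of d f = (\<Sum>i=1..d. single i (f i))"

definition psum :: "rvec \<Rightarrow> nat \<Rightarrow> real" where
  "psum x j = (\<Sum>i=1..j. lookup x i)"

text \<open>The \<open>d + 1\<close> coordinates \<open>t 0\<close>, ..., \<open>t d\<close> matter
  only up to adding a common constant.\<close>

definition increments :: "nat \<Rightarrow> (nat \<Rightarrow> real) \<Rightarrow> rvec" where
  "increments d t = vec_of d (\<lambda>i. t i - t (i - 1))"

text \<open>For \<open>r\<close> \<ge> 0 this is the dilate of the dual polytope by
  \<open>r\<close>; for negative \<open>r\<close> it is empty. The factor is real because points of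
  a free sum split their scale into arbitrary real parts.\<close>

definition slab :: "nat \<Rightarrow> real \<Rightarrow> rvec set" where
  "slab d r = {x \<in> Rn d. \<forall>i\<le>d. \<forall>j\<le>d. psum x j - psum x i \<le> r}"

lemma lookup_scaleR [simp]: "lookup (r *\<^sub>R x) i = r *\<^sub>R lookup x i"
  by (simp add: scaleR_poly_mapping_def)

lemma Rn_iff: "x \<in> Rn d \<longleftrightarrow> (\<forall>i. i \<notin> {1..d} \<longrightarrow> lookup x i = 0)"
  by (auto simp: Rn_def in_keys_iff)

lemma lookup_vec_of [simp]: "lookup (vec_of d f) i = (if i \<in> {1..d} then f i else 0)"
  by (auto simp: vec_of_def lookup_sum lookup_single when_def)

lemma vec_of_in_Rn [simp]: "vec_of d f \<in> Rn d"
  by (simp add: Rn_iff)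

lemma increments_in_Rn [simp]: "increments d t \<in> Rn d"
  by (simp add: increments_def)

lemma lookup_increments: "lookup (increments d t) i = (if i \<in> {1..d} then t i - t (i - 1) else 0)"
  by (simp add: increments_def)

lemma zero_in_Rn [simp]: "0 \<in> Rn d"
  by (simp add: Rn_iff)

lemma add_in_Rn: "x \<in> Rn d \<Longrightarrow> y \<in> Rn d \<Longrightarrow> x + y \<in> Rn d"
  by (simp add: Rn_iff lookup_add)

lemma scaleR_in_Rn: "x \<in> Rn d \<Longrightarrow> c *\<^sub>R x \<in> Rn d"
  by (simp add: Rn_iff)

lemma psum_0 [simp]: "psum x 0 = 0"
  by (simp add: psum_def)

lemma psum_Suc: "psum x (Suc j) = psum x j + lookup x (Suc j)"
  by (simp add: psum_def)

lemma psum_zero [simp]: "psum 0 j = 0"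
  by (simp add: psum_def)

lemma psum_add: "psum (x + y) j = psum x j + psum y j"
  by (simp add: psum_def lookup_add sum.distrib)

lemma psum_scaleR: "psum (c *\<^sub>R x) j = c * psum x j"
  by (simp add: psum_def sum_distrib_left)

lemma psum_increments: "j \<le> d \<Longrightarrow> psum (increments d t) j = t j - t 0"
  by (induction j) (auto simp: psum_Suc lookup_increments)

lemma increments_psum: "x \<in> Rn d \<Longrightarrow> increments d (\<lambda>i. psum x i - c) = x"
proof (rule poly_mapping_eqI)
  fix i assume "x \<in> Rn d"
  then show "lookup (increments d (\<lambda>i. psum x i - c)) i = lookup x i"
    by (cases i) (auto simp: lookup_increments psum_Suc Rn_iff)
qed

lemma psum_determines:
  assumes "x \<in> Rn d" "y \<in> Rn d" "\<And>j. j \<le> d \<Longrightarrow> psum x j = psum y j"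
  shows "x = y"
proof (rule poly_mapping_eqI)
  fix i
  show "lookup x i = lookup y i"
  proof (cases "i \<in> {1..d}")
    case True
    then obtain k where "i = Suc k" by (cases i) auto
    with True show ?thesis
      using assms(3)[of i] assms(3)[of k] by (simp add: psum_Suc)
  qed (use assms in \<open>auto simp: Rn_iff\<close>)
qed

section \<open>Slabs and their description as images of cubes\<close>

lemma slab_D: "x \<in> slab d r \<Longrightarrow> i \<le> d \<Longrightarrow> j \<le> d \<Longrightarrow> psum x j - psum x i \<le> r"
  by (simp add: slab_def)

lemma slab_in_Rn: "x \<in> slab d r \<Longrightarrow> x \<in> Rn d"
  by (simp add: slab_def)

lemma slab_nonneg: "x \<in> slab d r \<Longrightarrow> 0 \<le> r"
  using slab_D[of x d r 0 0] by simp

lemma slab_mono: "x \<in> slab d r \<Longrightarrow> r \<le> s \<Longrightarrow> x \<in> slab d s"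
  by (fastforce simp: slab_def)

lemma zero_in_slab: "0 \<le> r \<Longrightarrow> 0 \<in> slab d r"
  by (simp add: slab_def)

lemma slab_zero: "x \<in> slab d 0 \<Longrightarrow> x = 0"
proof (rule psum_determines[of _ d])
  fix j assume "x \<in> slab d 0" "j \<le> d"
  then show "psum x j = psum 0 j"
    using slab_D[of x d 0 0 j] slab_D[of x d 0 j 0] by simp
qed (simp_all add: slab_in_Rn)

lemma slab_add: "x \<in> slab d r \<Longrightarrow> y \<in> slab d s \<Longrightarrow> x + y \<in> slab d (r + s)"
  unfolding slab_def by (auto simp: add_in_Rn psum_add) (smt (verit))

lemma slab_scaleR: "x \<in> slab d r \<Longrightarrow> 0 \<le> c \<Longrightarrow> c *\<^sub>R x \<in> slab d (c * r)"
  unfolding slab_def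
  by (auto simp: scaleR_in_Rn psum_scaleR simp flip: right_diff_distrib intro!: mult_left_mono)

lemma increments_in_slab:
  assumes "\<And>i. i \<le> d \<Longrightarrow> 0 \<le> t i \<and> t i \<le> r"
  shows "increments d t \<in> slab d r"
proof -
  have "t j - t i \<le> r" if "i \<le> d" "j \<le> d" for i j
    using assms[of i] assms[of j] that by simp
  then show ?thesis by (simp add: slab_def psum_increments)
qed

text \<open>Subtracting the least partial sum \<mu> moves the partial sums into the cube with side
  \<open>r\<close>. That \<mu> is attained gives a zero coordinate, and for lattice points it makes
  \<mu> an integer.\<close>

lemma slab_obtains_increments:
  assumes "x \<in> slab d r"
  obtains \<mu> where "\<mu> \<in> psum x ` {..d}" "\<And>i. i \<le> d \<Longrightarrow> 0 \<le> psum x i - \<mu> \<and> psum x i - \<mu> \<le> r"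
    "increments d (\<lambda>i. psum x i - \<mu>) = x"
proof -
  define \<mu> where "\<mu> = Min (psum x ` {..d})"
  have "\<mu> \<in> psum x ` {..d}" unfolding \<mu>_def by (intro Min_in) auto
  moreover have "\<mu> \<le> psum x i" if "i \<le> d" for i
    unfolding \<mu>_def using that by (intro Min_le) auto
  ultimately show thesis
    using assms by (intro that[of \<mu>]) (auto simp: slab_D increments_psum slab_in_Rn)
qed

text \<open>A cube is the hull of its vertices, and \<open>increments\<close> is linear in
  \<open>t\<close>. The induction frees one coordinate at a time: those below \<open>k\<close> range
  over the unit interval, the others are still 0 or 1.\<close>

lemma slab_1_hull: "slab d 1 = convex hull (increments d ` ({..d} \<rightarrow>\<^sub>E {0, 1}))" (is "_ = convex hull ?V")
proof
  have "increments d t \<in> convex hull ?V"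
    if "k \<le> Suc d" "\<And>i. i < k \<Longrightarrow> 0 \<le> t i \<and> t i \<le> 1" "\<And>i. k \<le> i \<Longrightarrow> i \<le> d \<Longrightarrow> t i \<in> {0, 1}" for k t
    using that
  proof (induction k arbitrary: t)
    case 0
    \<comment> \<open>Elements of the extensional function space are fixed outside
      \<open>{..d}\<close>, where \<open>increments\<close> does not look.\<close>
    have "increments d t = increments d (restrict t {..d})"
      by (rule poly_mapping_eqI) (auto simp: lookup_increments)
    moreover have "restrict t {..d} \<in> {..d} \<rightarrow>\<^sub>E {0, 1}" using 0 by auto
    ultimately show ?case by (metis hull_inc image_eqI)
  next
    case (Suc k)
    have "increments d t = (1 - t k) *\<^sub>R increments d (t(k := 0)) + t k *\<^sub>R increments d (t(k := 1))"
      by (rule poly_mapping_eqI) (auto simp: lookup_increments lookup_add left_diff_distrib right_diff_distrib)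
    also have "\<dots> \<in> convex hull ?V"
      using Suc.prems(2)[of k]
      by (intro convexD_alt[OF convex_convex_hull] Suc.IH) (use Suc.prems in \<open>auto simp: less_Suc_eq_le\<close>)
    finally show ?case .
  qed
  note * = this[of "Suc d"]
  show "slab d 1 \<subseteq> convex hull ?V"
  proof
    fix x assume "x \<in> slab d 1"
    then obtain \<mu> where "\<And>i. i \<le> d \<Longrightarrow> 0 \<le> psum x i - \<mu> \<and> psum x i - \<mu> \<le> 1"
      "increments d (\<lambda>i. psum x i - \<mu>) = x"
      using slab_obtains_increments by metis
    then show "x \<in> convex hull ?V" using *[of "\<lambda>i. psum x i - \<mu>"] by auto
  qed
  have "convex (slab d 1)"
  proof (rule convexI)
    fix x y and u v :: real
    assume "x \<in> slab d 1" "y \<in> slab d 1" "0 \<le> u" "0 \<le> v" "u + v = 1"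
    then show "u *\<^sub>R x + v *\<^sub>R y \<in> slab d 1"
      using slab_add[OF slab_scaleR[of x d 1 u] slab_scaleR[of y d 1 v]] by simp
  qed
  moreover have "?V \<subseteq> slab d 1"
  proof
    fix x assume "x \<in> ?V"
    then obtain t where t: "t \<in> {..d} \<rightarrow>\<^sub>E {0, 1}" "x = increments d t" by blast
    then have "t i \<in> {0, 1}" if "i \<le> d" for i using that by auto
    then show "x \<in> slab d 1" unfolding t(2) by (intro increments_in_slab) force
  qed
  ultimately show "convex hull ?V \<subseteq> slab d 1" by (rule hull_minimal[rotated])
qed

section \<open>Pairings, polars and the dual polytope as a slab\<close>

lemma dot_add_right: "dot d x (y + z) = dot d x y + dot d x z"
  by (simp add: dot_def lookup_add algebra_simps sum.distrib)

lemma dot_scaleR_right: "dot d x (c *\<^sub>R y) = c * dot d x y"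
  by (simp add: dot_def sum_distrib_left algebra_simps)

lemma dot_commute: "dot d x y = dot d y x"
  by (simp add: dot_def mult.commute)

lemma convex_dot_ge: "convex {y. c \<le> dot d x y}"
proof (rule convexI)
  fix y z and u v :: real
  assume "y \<in> {y. c \<le> dot d x y}" "z \<in> {y. c \<le> dot d x y}" "0 \<le> u" "0 \<le> v" "u + v = 1"
  then have "u * c + v * c \<le> u * dot d x y + v * dot d x z"
    by (intro add_mono mult_left_mono) auto
  moreover have "u * c + v * c = c" using \<open>u + v = 1\<close> by (simp flip: distrib_right)
  ultimately show "u *\<^sub>R y + v *\<^sub>R z \<in> {y. c \<le> dot d x y}"
    by (simp add: dot_add_right dot_scaleR_right)
qed

lemma convex_Rn: "convex (Rn d)"
  by (rule convexI) (simp add: add_in_Rn scaleR_in_Rn)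

lemma convex_polar: "convex (polar d Q)"
proof -
  have "polar d Q = Rn d \<inter> (\<Inter>y\<in>Q. {x. -1 \<le> dot d y x})"
    by (auto simp: polar_def dot_commute)
  then show ?thesis by (simp add: convex_Int convex_Rn convex_INT convex_dot_ge)
qed

lemma polar_hull: "polar d (convex hull Q) = polar d Q"
proof
  show "polar d (convex hull Q) \<subseteq> polar d Q"
    unfolding polar_def by (auto simp: hull_inc)
  show "polar d Q \<subseteq> polar d (convex hull Q)"
  proof
    fix x assume x: "x \<in> polar d Q"
    then have "convex hull Q \<subseteq> {y. -1 \<le> dot d x y}"
      by (intro hull_minimal convex_dot_ge) (auto simp: polar_def)
    then show "x \<in> polar d (convex hull Q)" using x by (auto simp: polar_def)
  qed
qed

text \<open>Pairing \<open>x\<close> with a block of consecutive unit vectors from \<open>i\<close>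
  to \<open>j\<close> gives a difference of two partial sums, and the index pairs
  \<open>i - 1 < j\<close> are all ordered pairs in \<open>{..d}\<close>. The two signs of the
  generators supply both orders.\<close>

lemma A_dual_eq_slab: "A_dual d = slab d 1"
proof (cases "d = 0")
  case True
  have "x = 0" if "x \<in> Rn 0" for x
    using that by (intro poly_mapping_eqI) (simp add: Rn_iff)
  then show ?thesis using True by (auto simp: A_dual_def slab_def)
next
  case False
  have dot: "dot d x (\<Sum>k=i..j. unit_vec k) = psum x j - psum x (i - 1)"
    if "1 \<le> i" "i \<le> j" "j \<le> d" for x i j
  proof -
    have "lookup (\<Sum>k=i..j. unit_vec k) k = (if k \<in> {i..j} then 1 else 0)" for k
      by (simp add: lookup_sum unit_vec_def lookup_single when_def)
    then have "dot d x (\<Sum>k=i..j. unit_vec k) = (\<Sum>k=1..d. if k \<in> {i..j} then lookup x k else 0)"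
      unfolding dot_def by (intro sum.cong) auto
    also have "\<dots> = (\<Sum>k=i..j. lookup x k)"
      using that by (subst sum.inter_restrict[symmetric]) (auto intro!: sum.cong)
    also have "\<dots> = psum x j - psum x (i - 1)"
    proof -
      have "{1..j} = {1..i-1} \<union> {i..j}" using that by auto
      then show ?thesis unfolding psum_def by (simp, subst sum.union_disjoint) auto
    qed
    finally show ?thesis .
  qed
  have dot_uminus: "dot d x (- y) = - dot d x y" for x y
    by (simp add: dot_def sum_negf)
  have "x \<in> polar d (A_polytope d) \<longleftrightarrow> x \<in> slab d 1" for x
  proof -
    have "x \<in> polar d (A_polytope d) \<longleftrightarrow> x \<in> Rn d \<and> (\<forall>i\<in>{1..d}. \<forall>j\<in>{i..d}.
        -1 \<le> psum x j - psum x (i - 1) \<and> psum x j - psum x (i - 1) \<le> 1)"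
      unfolding A_polytope_def polar_hull unfolding polar_def
      by (auto simp: dot dot_uminus ball_Un simp del: minus_diff_eq)
    also have "\<dots> \<longleftrightarrow> x \<in> slab d 1"
    proof
      assume R: "x \<in> Rn d \<and> (\<forall>i\<in>{1..d}. \<forall>j\<in>{i..d}.
        -1 \<le> psum x j - psum x (i - 1) \<and> psum x j - psum x (i - 1) \<le> 1)"
      have *: "\<bar>psum x j - psum x i\<bar> \<le> 1" if "i < j" "j \<le> d" for i j
        using R[THEN conjunct2, rule_format, of "Suc i" j] that by auto
      have "psum x j - psum x i \<le> 1" if "i \<le> d" "j \<le> d" for i j
        using *[of i j] *[of j i] that by (cases i j rule: linorder_cases) auto
      then show "x \<in> slab d 1" using R by (simp add: slab_def)
    next
      assume x: "x \<in> slab d 1"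
      show "x \<in> Rn d \<and> (\<forall>i\<in>{1..d}. \<forall>j\<in>{i..d}.
        -1 \<le> psum x j - psum x (i - 1) \<and> psum x j - psum x (i - 1) \<le> 1)"
      proof (intro conjI ballI)
        fix i j assume "i \<in> {1..d}" "j \<in> {i..d}"
        then show "-1 \<le> psum x j - psum x (i - 1)" "psum x j - psum x (i - 1) \<le> 1"
          using slab_D[OF x, of j "i - 1"] slab_D[OF x, of "i - 1" j] by simp_all linarith+
      qed (rule slab_in_Rn[OF x])
    qed
    finally show ?thesis .
  qed
  then show ?thesis using False by (auto simp: A_dual_def)
qed

text \<open>For \<open>a < b\<close> this is the generator of \<open>A_polytope d\<close> with
  support from \<open>a + 1\<close> to \<open>b\<close>, for \<open>b < a\<close> it is the negative
  of such a generator, and for \<open>a = b\<close> it is zero.\<close>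

definition seg :: "nat \<Rightarrow> nat \<Rightarrow> nat \<Rightarrow> rvec" where
  "seg d a b = vec_of d (\<lambda>i. of_bool (a < i) - of_bool (b < i))"

lemma seg_in_Rn [simp]: "seg d a b \<in> Rn d"
  by (simp add: seg_def)

lemma sum_of_bool_less_psum:
  assumes "a \<le> d"
  shows "(\<Sum>i=1..d. of_bool (a < i) * lookup x i) = psum x d - psum x a"
proof -
  have "(\<Sum>i=1..d. of_bool (a < i) * lookup x i) = (\<Sum>i=Suc a..d. lookup x i)"
    by (intro sum.mono_neutral_cong_right) auto
  moreover have "psum x d = psum x a + (\<Sum>i=Suc a..d. lookup x i)"
  proof -
    have "{1..d} = {1..a} \<union> {Suc a..d}" using assms by auto
    then show ?thesis unfolding psum_def by (simp, subst sum.union_disjoint) auto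
  qed
  ultimately show ?thesis by simp
qed

lemma dot_seg:
  assumes "a \<le> d" "b \<le> d"
  shows "dot d (seg d a b) x = psum x b - psum x a"
proof -
  have "dot d (seg d a b) x = (\<Sum>i=1..d. of_bool (a < i) * lookup x i) - (\<Sum>i=1..d. of_bool (b < i) * lookup x i)"
    unfolding dot_def seg_def sum_subtractf[symmetric]
    by (intro sum.cong) (auto simp: algebra_simps)
  then show ?thesis using sum_of_bool_less_psum assms by simp
qed

text \<open>This is the bipolar identity for \<open>A_polytope\<close> with an explicit
  decomposition; the generators are integral, as reflexivity demands.\<close>

lemma polar_slab: "polar d (slab d 1) = convex hull ((\<lambda>(a, b). seg d a b) ` ({..d} \<times> {..d}))"
  (is "_ = convex hull ?S")
proof
  show "convex hull ?S \<subseteq> polar d (slab d 1)"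
  proof (intro hull_minimal convex_polar subsetI)
    fix y assume "y \<in> ?S"
    then obtain a b where "a \<le> d" "b \<le> d" "y = seg d a b" by auto
    then show "y \<in> polar d (slab d 1)"
      using slab_D[of _ d 1 b a] by (fastforce simp: polar_def dot_seg seg_in_Rn)
  qed
  show "polar d (slab d 1) \<subseteq> convex hull ?S"
  proof
    fix y assume y: "y \<in> polar d (slab d 1)"
    then have yR: "y \<in> Rn d" by (simp add: polar_def)
    txt \<open>In the coordinates \<open>w\<close>, \<open>y\<close> is a flow with sources \<open>P\<close> and sinks \<open>N\<close>, and \<open>seg d a b\<close> is a unit of
      flow from \<open>a\<close> to \<open>b\<close>; the product transport plan \<open>P a * N b / M\<close> decomposes \<open>y\<close>. Testing against
      the indicator of \<open>w > 0\<close> bounds its total mass \<open>M\<close> by \<open>1\<close>.\<close>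
    define w where "w k = lookup y (Suc k) - lookup y k" for k
    define P where "P k = max (w k) 0" for k
    define N where "N k = max (- w k) 0" for k
    have PN: "P k \<ge> 0" "N k \<ge> 0" "P k - N k = w k" for k
      by (auto simp: P_def N_def)
    define M where "M = (\<Sum>k\<le>d. P k)"
    have tele: "(\<Sum>k<i. w k) = lookup y i" for i
      using yR by (induction i) (auto simp: w_def Rn_iff)
    \<comment> \<open>Sources and sinks balance because \<open>y\<close> vanishes at index
      \<open>d + 1\<close>.\<close>
    have w0: "(\<Sum>k\<le>d. w k) = 0"
      using tele[of "Suc d"] yR by (simp add: lessThan_Suc_atMost Rn_iff)
    have NM: "(\<Sum>k\<le>d. N k) = M"
    proof -
      have "(\<Sum>k\<le>d. P k) - (\<Sum>k\<le>d. N k) = (\<Sum>k\<le>d. w k)"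
        by (simp add: PN(3) flip: sum_subtractf)
      then show ?thesis using w0 by (simp add: M_def)
    qed
    \<comment> \<open>Summation by parts. The boundary term at \<open>k + 1\<close> is kept for the
      induction and vanishes for \<open>k = d\<close>.\<close>
    have abel: "(\<Sum>i=1..k. lookup y i * (t i - t (i - 1))) = lookup y (Suc k) * t k - (\<Sum>i\<le>k. t i * w i)"
      for t and k
      using yR by (induction k) (auto simp: w_def algebra_simps Rn_iff)
    have M1: "M \<le> 1"
    proof -
      define t where "t i = (of_bool (w i > 0) :: real)" for i
      have "increments d t \<in> slab d 1" by (rule increments_in_slab) (simp add: t_def)
      then have "-1 \<le> dot d y (increments d t)" using y by (auto simp: polar_def)
      also have "\<dots> = (\<Sum>i=1..d. lookup y i * (t i - t (i - 1)))"
        unfolding dot_def by (intro sum.cong) (auto simp: lookup_increments)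
      also have "\<dots> = - (\<Sum>i\<le>d. t i * w i)"
        unfolding abel using yR by (simp add: Rn_iff)
      also have "\<dots> = - M"
        unfolding M_def by (intro arg_cong[of _ _ uminus] sum.cong) (auto simp: t_def P_def)
      finally show ?thesis by simp
    qed
    have seg0: "seg d 0 0 = 0" by (rule poly_mapping_eqI) (simp add: seg_def)
    have 0: "0 \<in> convex hull ?S"
      by (rule hull_inc) (use seg0 in \<open>force intro: rev_image_eqI[of "(0, 0)"]\<close>)
    have M0: "M \<ge> 0" unfolding M_def by (intro sum_nonneg PN)
    show "y \<in> convex hull ?S"
    proof (cases "M = 0")
      case True
      have "\<forall>k\<in>{..d}. P k = 0"
        using True unfolding M_def by (subst (asm) sum_nonneg_eq_0_iff) (auto simp: PN)
      moreover have "\<forall>k\<in>{..d}. N k = 0"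
        using True NM sum_nonneg_eq_0_iff[of "{..d}" N] by (simp add: PN)
      ultimately have "w k = 0" if "k \<le> d" for k using that PN(3)[of k] by simp
      then have "lookup y i = 0" if "i \<le> Suc d" for i
        using tele[of i] that by (simp add: sum.neutral)
      then have "y = 0"
        using yR by (intro poly_mapping_eqI) (metis Rn_iff atLeastAtMost_iff le_SucI lookup_zero)
      then show ?thesis using 0 by simp
    next
      case False
      \<comment> \<open>One more division by \<open>M\<close> than in the transport plan: these
        weights sum to 1 and yield \<open>(1 / M) *\<^sub>R y\<close>.\<close>
      let ?c = "\<lambda>(a, b). P a * N b / M\<^sup>2"
      have prod: "(\<Sum>(a, b)\<in>{..d}\<times>{..d}. f a * g b / M\<^sup>2) = (\<Sum>a\<le>d. f a) * (\<Sum>b\<le>d. g b) / M\<^sup>2"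
        for f g :: "nat \<Rightarrow> real"
        by (simp add: sum_product sum.cartesian_product sum_divide_distrib split_def)
      have "(\<Sum>q\<in>{..d}\<times>{..d}. ?c q *\<^sub>R (case q of (a, b) \<Rightarrow> seg d a b)) \<in> convex hull ?S"
      proof (rule convex_sum)
        show "sum ?c ({..d} \<times> {..d}) = 1"
          using False by (simp add: prod NM flip: M_def) (simp add: power2_eq_square)
        show "0 \<le> ?c q" for q using PN by (auto split: prod.split)
        show "(case q of (a, b) \<Rightarrow> seg d a b) \<in> convex hull ?S" if "q \<in> {..d} \<times> {..d}" for q
          using that by (intro hull_inc imageI)
      qed auto
      also have "(\<Sum>q\<in>{..d}\<times>{..d}. ?c q *\<^sub>R (case q of (a, b) \<Rightarrow> seg d a b)) = (1 / M) *\<^sub>R y"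
      proof (rule poly_mapping_eqI)
        fix i
        show "lookup (\<Sum>q\<in>{..d}\<times>{..d}. ?c q *\<^sub>R (case q of (a, b) \<Rightarrow> seg d a b)) i = lookup ((1 / M) *\<^sub>R y) i"
        proof (cases "i \<in> {1..d}")
          case True
          have cut: "(\<Sum>a\<le>d. g a * of_bool (a < i)) = (\<Sum>a<i. g a)" for g :: "nat \<Rightarrow> real"
            using True by (intro sum.mono_neutral_cong_right) auto
          have "lookup (\<Sum>q\<in>{..d}\<times>{..d}. ?c q *\<^sub>R (case q of (a, b) \<Rightarrow> seg d a b)) i
              = (\<Sum>(a, b)\<in>{..d}\<times>{..d}. (P a * of_bool (a < i)) * N b / M\<^sup>2)
              - (\<Sum>(a, b)\<in>{..d}\<times>{..d}. P a * (N b * of_bool (b < i)) / M\<^sup>2)"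
            using True unfolding lookup_sum sum_subtractf[symmetric]
            by (intro sum.cong) (auto simp: seg_def algebra_simps)
          also have "\<dots> = (\<Sum>a<i. P a) * M / M\<^sup>2 - M * (\<Sum>a<i. N a) / M\<^sup>2"
            unfolding prod cut NM by (simp add: M_def)
          also have "\<dots> = (1 / M) * ((\<Sum>a<i. P a) - (\<Sum>a<i. N a))"
            using False by (simp add: field_simps power2_eq_square)
          also have "(\<Sum>a<i. P a) - (\<Sum>a<i. N a) = lookup y i"
            by (simp add: PN(3) tele flip: sum_subtractf)
          finally show ?thesis by simp
        next
          case False
          then have "lookup (seg d a b) i = 0" for a b by (auto simp: seg_def)
          moreover have "lookup y i = 0" using False yR by (auto simp: Rn_iff)
          ultimately show ?thesis by (simp add: lookup_sum split_def)
        qed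
      qed
      \<comment> \<open>Since \<open>M\<close> \<le> 1, \<open>y\<close> lies on the segment from
        the origin to \<open>(1 / M) *\<^sub>R y\<close>.\<close>
      finally have "(1 - M) *\<^sub>R 0 + M *\<^sub>R ((1 / M) *\<^sub>R y) \<in> convex hull ?S"
        using M0 M1 0 by (intro convexD_alt convex_convex_hull) auto
      then show ?thesis using False by simp
    qed
  qed
qed

subsection \<open>Free sums and reflexivity\<close>

text \<open>At the overlap \<open>i = m\<close> both arguments contribute, but
  \<open>lookup y 0\<close> is zero as soon as \<open>y\<close> lies in some
  \<open>Rn n\<close>.\<close>

lemma lookup_vpair:
  "lookup (vpair m x y) i = lookup x i + (if m \<le> i then lookup y (i - m) else 0)"
proof -
  have "(\<Sum>j\<in>Poly_Mapping.keys y. lookup (single (m + j) (lookup y j)) i)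
      = (\<Sum>j\<in>Poly_Mapping.keys y. if j = i - m then (if m \<le> i then lookup y j else 0) else 0)"
    by (intro sum.cong) (auto simp: lookup_single when_def)
  also have "\<dots> = (if m \<le> i then lookup y (i - m) else 0)"
    by (simp add: in_keys_iff)
  finally show ?thesis by (simp add: vpair_def lookup_add lookup_sum)
qed

lemma vpair_add: "vpair m (x + x') (y + y') = vpair m x y + vpair m x' y'"
  by (rule poly_mapping_eqI) (simp add: lookup_vpair lookup_add)

lemma vpair_scaleR: "vpair m (c *\<^sub>R x) (c *\<^sub>R y) = c *\<^sub>R vpair m x y"
  by (rule poly_mapping_eqI) (simp add: lookup_vpair distrib_left)

lemma vpair_0 [simp]: "vpair m 0 0 = 0"
  by (simp add: vpair_def)

lemma lookup_Rn_0: "x \<in> Rn d \<Longrightarrow> i \<notin> {1..d} \<Longrightarrow> lookup x i = 0"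
  by (simp add: Rn_iff)

lemma vpair_in_Rn:
  assumes "x \<in> Rn m" "y \<in> Rn n"
  shows "vpair m x y \<in> Rn (m + n)"
  unfolding Rn_iff[of _ "m + n"]
proof (intro allI impI)
  fix i assume i: "i \<notin> {1..m + n}"
  have "lookup x i = 0" "lookup y (i - m) = 0"
    using i by (auto intro!: lookup_Rn_0[OF assms(1)] lookup_Rn_0[OF assms(2)])
  then show "lookup (vpair m x y) i = 0" by (simp add: lookup_vpair)
qed

lemma lookup_vpair_left: "i \<le> m \<Longrightarrow> y \<in> Rn n \<Longrightarrow> lookup (vpair m x y) i = lookup x i"
  by (auto simp: Rn_iff lookup_vpair)

lemma lookup_vpair_right: "0 < i \<Longrightarrow> x \<in> Rn m \<Longrightarrow> lookup (vpair m x y) (m + i) = lookup y i"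
  by (auto simp: Rn_iff lookup_vpair)

lemma vpair_inject:
  assumes "x \<in> Rn m" "x' \<in> Rn m" "y \<in> Rn n" "y' \<in> Rn n" "vpair m x y = vpair m x' y'"
  shows "x = x' \<and> y = y'"
proof (intro conjI poly_mapping_eqI)
  fix i
  show "lookup x i = lookup x' i"
    using lookup_vpair_left[of i m y n x] lookup_vpair_left[of i m y' n x'] assms
    by (cases "i \<le> m") (auto simp: Rn_iff)
  show "lookup y i = lookup y' i"
    using lookup_vpair_right[of i x m y] lookup_vpair_right[of i x' m y'] assms
    by (cases "i = 0") (auto simp: Rn_iff)
qed

lemma Rn_obtains_vpair:
  assumes "z \<in> Rn (m + n)"
  obtains x y where "x \<in> Rn m" "y \<in> Rn n" "z = vpair m x y"
proof
  show "z = vpair m (vec_of m (lookup z)) (vec_of n (\<lambda>i. lookup z (m + i)))"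
    using assms by (intro poly_mapping_eqI) (auto simp: lookup_vpair Rn_iff)
qed simp_all

lemma Zn_vpair_iff:
  assumes "x \<in> Rn m" "y \<in> Rn n"
  shows "vpair m x y \<in> Zn (m + n) \<longleftrightarrow> x \<in> Zn m \<and> y \<in> Zn n"
proof
  assume z: "vpair m x y \<in> Zn (m + n)"
  then have zi: "lookup (vpair m x y) i \<in> \<int>" for i by (simp add: Zn_def)
  have "lookup x i \<in> \<int>" for i
    using zi[of i] lookup_vpair_left[of i m y n x] assms by (cases "i \<le> m") (simp_all add: lookup_Rn_0)
  moreover have "lookup y i \<in> \<int>" for i
    using zi[of "m + i"] lookup_vpair_right[of i x m y] assms by (cases "i = 0") (simp_all add: lookup_Rn_0)
  ultimately show "x \<in> Zn m \<and> y \<in> Zn n" using assms by (simp add: Zn_def)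
next
  assume "x \<in> Zn m \<and> y \<in> Zn n"
  then show "vpair m x y \<in> Zn (m + n)"
    using assms by (auto simp: Zn_def vpair_in_Rn lookup_vpair)
qed

lemma sum_split_atLeast_1: "(\<Sum>i=1..m+n. f i) = (\<Sum>i=1..m. f i) + (\<Sum>i=1..n. f (m + i))"
  for f :: "nat \<Rightarrow> 'a::comm_monoid_add"
  by (induction n) (simp_all add: algebra_simps)

lemma dot_vpair:
  assumes "x \<in> Rn m" "x' \<in> Rn m" "y \<in> Rn n" "y' \<in> Rn n"
  shows "dot (m + n) (vpair m x y) (vpair m x' y') = dot m x x' + dot n y y'"
proof -
  have "(\<Sum>i=1..m. lookup (vpair m x y) i * lookup (vpair m x' y') i) = dot m x x'"
    unfolding dot_def by (intro sum.cong) (use assms in \<open>auto simp: lookup_vpair_left\<close>)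
  moreover have "(\<Sum>i=1..n. lookup (vpair m x y) (m + i) * lookup (vpair m x' y') (m + i)) = dot n y y'"
    unfolding dot_def by (intro sum.cong) (use assms in \<open>auto simp: lookup_vpair_right\<close>)
  ultimately show ?thesis unfolding dot_def[of "m + n"] sum_split_atLeast_1 by simp
qed

lemma linear_vpair: "linear (\<lambda>(x, y). vpair m x y)"
  by (rule linearI) (auto simp: vpair_add vpair_scaleR)

lemma linear_vpair_left: "linear (\<lambda>x. vpair m x 0)"
  using vpair_add[of m _ _ 0 0] vpair_scaleR[of m _ _ 0] by (intro linearI) auto

lemma linear_vpair_right: "linear (\<lambda>y. vpair m 0 y)"
  using vpair_add[of m 0 0] vpair_scaleR[of m _ 0] by (intro linearI) auto

text \<open>These are the pairs whose gauges with respect to the two dual polytopes add up to at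
  most \<open>r\<close>, that is, the dilate by \<open>r\<close> of their free sum.\<close>

definition slab_sum :: "nat \<Rightarrow> nat \<Rightarrow> real \<Rightarrow> rvec set" where
  "slab_sum m n r = {vpair m x y |x y a b. x \<in> slab m a \<and> y \<in> slab n b \<and> a + b \<le> r}"

lemma slab_sumI: "x \<in> slab m a \<Longrightarrow> y \<in> slab n b \<Longrightarrow> a + b \<le> r \<Longrightarrow> vpair m x y \<in> slab_sum m n r"
  unfolding slab_sum_def by blast

lemma slab_sum_add: "z \<in> slab_sum m n r \<Longrightarrow> w \<in> slab_sum m n s \<Longrightarrow> z + w \<in> slab_sum m n (r + s)"
proof -
  assume "z \<in> slab_sum m n r" "w \<in> slab_sum m n s"
  then obtain x y a b x' y' a' b' where
    "z = vpair m x y" "x \<in> slab m a" "y \<in> slab n b" "a + b \<le> r"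
    "w = vpair m x' y'" "x' \<in> slab m a'" "y' \<in> slab n b'" "a' + b' \<le> s"
    unfolding slab_sum_def by blast
  then show ?thesis
    using slab_sumI[OF slab_add[of x m a x' a'] slab_add[of y n b y' b'], of "r + s"]
    by (simp add: vpair_add)
qed

lemma slab_sum_scaleR: "z \<in> slab_sum m n r \<Longrightarrow> 0 \<le> c \<Longrightarrow> c *\<^sub>R z \<in> slab_sum m n (c * r)"
proof -
  assume "z \<in> slab_sum m n r" and c: "0 \<le> c"
  then obtain x y a b where z: "z = vpair m x y" "x \<in> slab m a" "y \<in> slab n b" "a + b \<le> r"
    unfolding slab_sum_def by blast
  have "vpair m (c *\<^sub>R x) (c *\<^sub>R y) \<in> slab_sum m n (c * r)"
    by (rule slab_sumI[of _ _ "c * a" _ _ "c * b"])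
      (use z c in \<open>auto simp: slab_scaleR simp flip: distrib_left intro: mult_left_mono\<close>)
  then show ?thesis by (simp add: vpair_scaleR z(1))
qed

lemma slab_sum_0: "z \<in> slab_sum m n 0 \<Longrightarrow> z = 0"
proof -
  assume "z \<in> slab_sum m n 0"
  then obtain x y a b where z: "z = vpair m x y" "x \<in> slab m a" "y \<in> slab n b" "a + b \<le> 0"
    unfolding slab_sum_def by blast
  then have "a = 0" "b = 0" using slab_nonneg[of x m a] slab_nonneg[of y n b] by auto
  then show ?thesis using z slab_zero[of x m] slab_zero[of y n] by simp
qed

text \<open>Scaling by \<open>1 / k\<close> inverts scaling by \<open>k\<close>. For
  \<open>k = 0\<close> both sides consist of the origin alone.\<close>

lemma scaleR_slab_sum: "(\<lambda>x. real k *\<^sub>R x) ` slab_sum m n 1 = slab_sum m n (real k)"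
proof
  show "(\<lambda>x. real k *\<^sub>R x) ` slab_sum m n 1 \<subseteq> slab_sum m n (real k)"
    using slab_sum_scaleR[of _ m n 1 "real k"] by auto
  show "slab_sum m n (real k) \<subseteq> (\<lambda>x. real k *\<^sub>R x) ` slab_sum m n 1"
  proof
    fix z assume z: "z \<in> slab_sum m n (real k)"
    show "z \<in> (\<lambda>x. real k *\<^sub>R x) ` slab_sum m n 1"
    proof (cases "k = 0")
      case True
      have "0 \<in> slab_sum m n 1"
        using slab_sumI[OF zero_in_slab[of 0 m] zero_in_slab[of 0 n], of 1] by (simp add: vpair_def)
      then show ?thesis using True z slab_sum_0[of z m n] by (auto intro: rev_image_eqI)
    next
      case False
      then show ?thesis
        using slab_sum_scaleR[OF z, of "1 / real k"]
        by (intro rev_image_eqI[of "(1 / real k) *\<^sub>R z"]) auto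
    qed
  qed
qed

text \<open>Additivity and homogeneity in the factor make \<open>slab_sum m n 1\<close> convex.
  Conversely, a pair with factors summing to 1 is the convex combination, with these factors as
  weights, of a point in each summand.\<close>

lemma free_sum_slab: "free_sum m (slab m 1) (slab n 1) = slab_sum m n 1"
proof
  have "convex (slab_sum m n 1)"
  proof (rule convexI)
    fix x y and u v :: real
    assume "x \<in> slab_sum m n 1" "y \<in> slab_sum m n 1" "0 \<le> u" "0 \<le> v" "u + v = 1"
    then show "u *\<^sub>R x + v *\<^sub>R y \<in> slab_sum m n 1"
      using slab_sum_add[OF slab_sum_scaleR[of x m n 1 u] slab_sum_scaleR[of y m n 1 v]] by simp
  qed
  then show "free_sum m (slab m 1) (slab n 1) \<subseteq> slab_sum m n 1"
    unfolding free_sum_def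
    using zero_in_slab[of 0 m] zero_in_slab[of 0 n]
    by (intro hull_minimal) (auto intro: slab_sumI[of _ _ 1 _ _ 0] slab_sumI[of _ _ 0 _ _ 1])
  show "slab_sum m n 1 \<subseteq> free_sum m (slab m 1) (slab n 1)"
  proof
    fix z assume "z \<in> slab_sum m n 1"
    then obtain x y a b where z: "z = vpair m x y" "x \<in> slab m a" "y \<in> slab n b" "a + b \<le> 1"
      unfolding slab_sum_def by blast
    have a: "0 \<le> a" using slab_nonneg z(2) .
    \<comment> \<open>Enlarging the second factor turns \<open>a + b\<close> \<le> 1 into an
      equality, so that the weights of the combination sum to 1.\<close>
    define b' where "b' = 1 - a"
    have y: "y \<in> slab n b'" using slab_mono[OF z(3), of b'] z(4) by (simp add: b'_def)
    have b: "0 \<le> b'" using slab_nonneg y .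
    have unit: "\<exists>x'\<in>slab d 1. x = c *\<^sub>R x'" if "x \<in> slab d c" "0 \<le> c" for x d c
    proof (cases "c = 0")
      case True
      then show ?thesis using that slab_zero zero_in_slab[of 1 d] by (intro bexI[of _ 0]) auto
    next
      case False
      then show ?thesis
        using slab_scaleR[OF that(1), of "1 / c"] that(2) by (intro bexI[of _ "(1 / c) *\<^sub>R x"]) auto
    qed
    obtain x' y' where xy: "x' \<in> slab m 1" "x = a *\<^sub>R x'" "y' \<in> slab n 1" "y = b' *\<^sub>R y'"
      using unit[OF z(2) a] unit[OF y b] by blast
    have "z = a *\<^sub>R vpair m x' 0 + b' *\<^sub>R vpair m 0 y'"
      by (simp add: z(1) xy flip: vpair_scaleR vpair_add)
    also have "\<dots> \<in> free_sum m (slab m 1) (slab n 1)"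
      unfolding free_sum_def using a b xy
      by (intro convexD[OF convex_convex_hull]) (auto simp: b'_def intro!: hull_inc)
    finally show "z \<in> free_sum m (slab m 1) (slab n 1)" .
  qed
qed

section \<open>Integrality, the polar of the free sum, and the interior condition\<close>

lemma integral_slab: "integral_polytope d (slab d 1)"
  unfolding integral_polytope_def slab_1_hull
proof (intro exI conjI)
  show "finite (increments d ` ({..d} \<rightarrow>\<^sub>E {0, 1}))" by (intro finite_imageI finite_PiE) auto
  have "t i \<in> \<int>" if "t \<in> {..d} \<rightarrow>\<^sub>E {0, 1::real}" "i \<le> d" for t i
  proof -
    have "t i \<in> {0, 1}" using that by auto
    then show ?thesis by auto
  qed
  then show "increments d ` ({..d} \<rightarrow>\<^sub>E {0, 1}) \<subseteq> Zn d"
    by (auto simp: Zn_def lookup_increments intro!: Ints_diff)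
qed simp

lemma integral_free_sum:
  assumes "integral_polytope m P" "integral_polytope n Q"
  shows "integral_polytope (m + n) (free_sum m P Q)"
proof -
  obtain V W where V: "finite V" "V \<subseteq> Zn m" "P = convex hull V"
    and W: "finite W" "W \<subseteq> Zn n" "Q = convex hull W"
    using assms unfolding integral_polytope_def by auto
  have "0 \<in> Zn d" for d by (simp add: Zn_def)
  then have "(\<lambda>x. vpair m x 0) ` V \<union> (\<lambda>y. vpair m 0 y) ` W \<subseteq> Zn (m + n)"
    using V W by (auto simp: Zn_vpair_iff Zn_def[of m] Zn_def[of n] subset_iff)
  moreover have "free_sum m P Q = convex hull ((\<lambda>x. vpair m x 0) ` V \<union> (\<lambda>y. vpair m 0 y) ` W)"
    unfolding free_sum_def V(3) W(3)
      convex_hull_linear_image[OF linear_vpair_left] convex_hull_linear_image[OF linear_vpair_right]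
    by (rule hull_Un[symmetric]) (simp add: convex_Inter)
  ultimately show ?thesis
    unfolding integral_polytope_def
    by (intro exI[of _ "(\<lambda>x. vpair m x 0) ` V \<union> (\<lambda>y. vpair m 0 y) ` W"]) (simp add: V W)
qed

text \<open>Polarity turns the free sum into a Cartesian product: a generator of the free sum has
  one zero component, so its inequality constrains only \<open>x\<close> or only
  \<open>y\<close>.\<close>

lemma polar_free_sum:
  assumes "P \<subseteq> Rn m" "Q \<subseteq> Rn n"
  shows "polar (m + n) (free_sum m P Q) = (\<lambda>(x, y). vpair m x y) ` (polar m P \<times> polar n Q)"
proof -
  have dot0: "dot d x 0 = 0" for d x by (simp add: dot_def)
  have "vpair m x y \<in> polar (m + n) (free_sum m P Q) \<longleftrightarrow> x \<in> polar m P \<and> y \<in> polar n Q"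
    if "x \<in> Rn m" "y \<in> Rn n" for x y
    unfolding free_sum_def polar_hull
    using that assms by (auto simp: polar_def vpair_in_Rn dot_vpair subset_iff dot0 ball_Un)
  note iff = this
  show ?thesis
  proof (intro equalityI subsetI)
    fix z assume z: "z \<in> polar (m + n) (free_sum m P Q)"
    then have "z \<in> Rn (m + n)" by (simp add: polar_def)
    then obtain x y where "x \<in> Rn m" "y \<in> Rn n" "z = vpair m x y"
      by (rule Rn_obtains_vpair)
    then show "z \<in> (\<lambda>(x, y). vpair m x y) ` (polar m P \<times> polar n Q)" using iff z by blast
  next
    fix z assume "z \<in> (\<lambda>(x, y). vpair m x y) ` (polar m P \<times> polar n Q)"
    then obtain x y where xy: "x \<in> polar m P" "y \<in> polar n Q" "z = vpair m x y" by auto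
    then have "x \<in> Rn m" "y \<in> Rn n" by (simp_all add: polar_def)
    then show "z \<in> polar (m + n) (free_sum m P Q)" using iff xy by blast
  qed
qed

lemma integral_polar_slab: "integral_polytope d (polar d (slab d 1))"
  unfolding integral_polytope_def polar_slab
proof (intro exI conjI)
  show "(\<lambda>(a, b). seg d a b) ` ({..d} \<times> {..d}) \<subseteq> Zn d" by (auto simp: Zn_def seg_def)
qed simp_all

lemma integral_image_vpair:
  assumes "integral_polytope m P" "integral_polytope n Q"
  shows "integral_polytope (m + n) ((\<lambda>(x, y). vpair m x y) ` (P \<times> Q))"
proof -
  obtain V W where V: "finite V" "V \<subseteq> Zn m" "P = convex hull V"
    and W: "finite W" "W \<subseteq> Zn n" "Q = convex hull W"
    using assms unfolding integral_polytope_def by auto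
  have "(\<lambda>(x, y). vpair m x y) ` (V \<times> W) \<subseteq> Zn (m + n)"
    using V W by (auto simp: Zn_vpair_iff Zn_def[of m] Zn_def[of n] subset_iff)
  moreover have "(\<lambda>(x, y). vpair m x y) ` (P \<times> Q) = convex hull ((\<lambda>(x, y). vpair m x y) ` (V \<times> W))"
    by (simp add: V W convex_hull_Times flip: convex_hull_linear_image[OF linear_vpair])
  ultimately show ?thesis
    unfolding integral_polytope_def
    by (intro exI[of _ "(\<lambda>(x, y). vpair m x y) ` (V \<times> W)"]) (simp add: V W)
qed

text \<open>A difference of partial sums is, up to sign, the sum of a block of coordinates, so the
  sum of absolute values bounds the gauge. Hence the unit ball of the norm lies in the free
  sum.\<close>

lemma slab_sum_abs:
  assumes "z \<in> Rn (m + n)"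
  shows "z \<in> slab_sum m n (\<Sum>i=1..m+n. \<bar>lookup z i\<bar>)"
proof -
  have slab: "x \<in> slab d (\<Sum>i=1..d. \<bar>lookup x i\<bar>)" if "x \<in> Rn d" for x d
  proof -
    have le: "psum x j - psum x i \<le> (\<Sum>i=1..d. \<bar>lookup x i\<bar>)" if "i \<le> d" "j \<le> d" for i j
    proof -
      have "psum x j - psum x i = (\<Sum>k=1..d. (of_bool (k \<le> j) - of_bool (k \<le> i)) * lookup x k)"
      proof -
        have "psum x j = (\<Sum>k=1..d. of_bool (k \<le> j) * lookup x k)" if "j \<le> d" for j
          unfolding psum_def using that by (intro sum.mono_neutral_cong_left) auto
        then show ?thesis using that by (simp add: left_diff_distrib sum_subtractf)
      qed
      also have "\<dots> \<le> (\<Sum>k=1..d. \<bar>lookup x k\<bar>)"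
        by (intro sum_mono) auto
      finally show ?thesis .
    qed
    then show ?thesis using that by (simp add: slab_def)
  qed
  obtain x y where xy: "x \<in> Rn m" "y \<in> Rn n" "z = vpair m x y"
    using assms by (rule Rn_obtains_vpair)
  have "(\<Sum>i=1..m+n. \<bar>lookup z i\<bar>) = (\<Sum>i=1..m. \<bar>lookup x i\<bar>) + (\<Sum>i=1..n. \<bar>lookup y i\<bar>)"
    unfolding sum_split_atLeast_1 xy(3) using xy
    by (intro arg_cong2[where f = "(+)"] sum.cong) (auto simp: lookup_vpair_left lookup_vpair_right)
  then show ?thesis
    using slab_sumI[OF slab[OF xy(1)] slab[OF xy(2)]] xy(3) by simp
qed

lemma norm_Rn: "z \<in> Rn d \<Longrightarrow> norm z = (\<Sum>i=1..d. \<bar>lookup z i\<bar>)"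
  unfolding norm_poly_mapping_def dist_poly_mapping_def
  by (auto simp: Rn_def in_keys_iff intro!: sum.mono_neutral_cong_left)

lemma zero_interior_slab_sum: "0 \<in> top_of_set (Rn (m + n)) interior_of slab_sum m n 1"
  unfolding interior_of_def
proof (intro CollectI exI conjI)
  show "openin (top_of_set (Rn (m + n))) (Rn (m + n) \<inter> ball 0 1)"
    by (intro openin_open_Int open_ball)
  show "0 \<in> Rn (m + n) \<inter> ball 0 1" by simp
  show "Rn (m + n) \<inter> ball 0 1 \<subseteq> slab_sum m n 1"
  proof
    fix z assume "z \<in> Rn (m + n) \<inter> ball 0 1"
    then have "z \<in> slab_sum m n (norm z)" "norm z < 1"
      using slab_sum_abs[of z m n] by (auto simp: norm_Rn)
    then show "z \<in> slab_sum m n 1" unfolding slab_sum_def by fastforce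
  qed
qed

lemma reflexive_free_sum_A_dual: "reflexive_polytope (m + n) (free_sum m (A_dual m) (A_dual n))"
  unfolding reflexive_polytope_def
proof (intro conjI)
  show "integral_polytope (m + n) (free_sum m (A_dual m) (A_dual n))"
    by (simp add: A_dual_eq_slab integral_free_sum integral_slab)
  show "0 \<in> top_of_set (Rn (m + n)) interior_of free_sum m (A_dual m) (A_dual n)"
    by (simp add: A_dual_eq_slab free_sum_slab zero_interior_slab_sum)
  have "slab d 1 \<subseteq> Rn d" for d by (auto simp: slab_in_Rn)
  then show "integral_polytope (m + n) (polar (m + n) (free_sum m (A_dual m) (A_dual n)))"
    by (simp add: A_dual_eq_slab polar_free_sum integral_image_vpair integral_polar_slab)
qed

subsection \<open>Counting lattice points\<close>

definition lat :: "nat \<Rightarrow> nat \<Rightarrow> rvec set" where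
  "lat d k = slab d (real k) \<inter> Zn d"

lemma psum_in_Ints: "x \<in> Zn d \<Longrightarrow> psum x j \<in> \<int>"
  unfolding psum_def by (intro Ints_sum) (simp add: Zn_def)

text \<open>Differences of partial sums of a lattice point are integers, so a real bound on them may
  be rounded down. This replaces real factors by natural ones in the count.\<close>

lemma lat_nat_floor:
  assumes "x \<in> slab d r" "x \<in> Zn d"
  shows "x \<in> lat d (nat \<lfloor>r\<rfloor>)"
proof -
  have "psum x j - psum x i \<le> real (nat \<lfloor>r\<rfloor>)" if "i \<le> d" "j \<le> d" for i j
  proof -
    obtain z :: int where "psum x j - psum x i = of_int z"
      using Ints_diff[OF psum_in_Ints psum_in_Ints] assms(2) by (meson Ints_cases)
    moreover have "psum x j - psum x i \<le> r" using slab_D assms(1) that by blast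
    ultimately show ?thesis using slab_nonneg[OF assms(1)] by (simp add: le_floor_iff)
  qed
  then show ?thesis using assms by (simp add: lat_def slab_def)
qed

lemma lat_mono: "a \<le> b \<Longrightarrow> lat d a \<subseteq> lat d b"
  unfolding lat_def by (auto intro: slab_mono)

text \<open>Shifting the least coordinate to 0 singles out one representative \<open>t\<close> for
  each lattice point; the tuples removed are those with no zero coordinate.\<close>

lemma bij_betw_lat:
  "bij_betw (\<lambda>t. increments d (\<lambda>i. real (t i))) (({..d} \<rightarrow>\<^sub>E {0..k}) - ({..d} \<rightarrow>\<^sub>E {1..k})) (lat d k)"
  (is "bij_betw ?f ?T _")
proof -
  have T: "t \<in> ?T \<longleftrightarrow> t \<in> {..d} \<rightarrow>\<^sub>E {0..k} \<and> (\<exists>i\<le>d. t i = 0)" for t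
    by (auto simp: PiE_iff Ball_def)
  have "inj_on ?f ?T"
  proof (rule inj_onI)
    fix t t' assume t: "t \<in> ?T" "t' \<in> ?T" and eq: "?f t = ?f t'"
    have *: "real (t j) - real (t 0) = real (t' j) - real (t' 0)" if "j \<le> d" for j
      using arg_cong[OF eq, of "\<lambda>x. psum x j"] that by (simp add: psum_increments)
    obtain i j where ij: "i \<le> d" "t i = 0" "j \<le> d" "t' j = 0" using t T by auto
    \<comment> \<open>At a zero of \<open>t\<close> the equation \<open>*\<close> gives
      \<open>t 0\<close> \<le> \<open>t' 0\<close>, and at a zero of \<open>t'\<close> it gives the
      converse.\<close>
    have "t 0 = t' 0" using *[OF ij(1)] *[OF ij(3)] ij by simp
    then have "t j = t' j" if "j \<le> d" for j using *[OF that] by simp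
    then show "t = t'" using t by (intro PiE_ext[of t "{..d}" "\<lambda>_. {0..k}"]) auto
  qed
  moreover have "?f ` ?T = lat d k"
  proof (intro equalityI subsetI)
    fix x assume "x \<in> ?f ` ?T"
    then obtain t where t: "t \<in> {..d} \<rightarrow>\<^sub>E {0..k}" "x = ?f t" by auto
    then have "t i \<le> k" if "i \<le> d" for i using that by auto
    then have "x \<in> slab d (real k)" unfolding t(2) by (intro increments_in_slab) auto
    then show "x \<in> lat d k" by (auto simp: lat_def Zn_def slab_in_Rn t(2) lookup_increments)
  next
    fix x assume x: "x \<in> lat d k"
    then obtain \<mu> where mu: "\<mu> \<in> psum x ` {..d}" "\<And>i. i \<le> d \<Longrightarrow> 0 \<le> psum x i - \<mu> \<and> psum x i - \<mu> \<le> real k"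
      "increments d (\<lambda>i. psum x i - \<mu>) = x"
      unfolding lat_def using slab_obtains_increments by blast
    define t where "t = restrict (\<lambda>i. nat \<lfloor>psum x i - \<mu>\<rfloor>) {..d}"
    have t: "real (t i) = psum x i - \<mu>" if "i \<le> d" for i
    proof -
      have "psum x i - \<mu> \<in> \<int>" using mu(1) x by (auto simp: lat_def intro!: Ints_diff psum_in_Ints)
      then show ?thesis using mu(2)[OF that] that by (auto simp: t_def elim!: Ints_cases)
    qed
    have "t i \<le> k" if "i \<le> d" for i using mu(2)[OF that] t[OF that] by simp
    moreover have "\<exists>i\<le>d. t i = 0" using mu(1) t by force
    moreover have "t \<in> extensional {..d}" by (simp add: t_def)
    ultimately have "t \<in> ?T" unfolding T by (auto simp: PiE_iff)
    moreover have "?f t = increments d (\<lambda>i. psum x i - \<mu>)"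
      by (rule poly_mapping_eqI) (auto simp: lookup_increments t)
    ultimately show "x \<in> ?f ` ?T" using mu(3) by (metis image_eqI)
  qed
  ultimately show ?thesis by (simp add: bij_betw_def)
qed

lemma finite_lat: "finite (lat d k)"
  using bij_betw_finite[OF bij_betw_lat, of d k] by (simp add: finite_PiE)

lemma card_lat: "card (lat d k) = (k + 1) ^ (d + 1) - k ^ (d + 1)"
proof -
  have "card (lat d k) = card (({..d} \<rightarrow>\<^sub>E {0..k}) - ({..d} \<rightarrow>\<^sub>E {1..k}))"
    by (rule bij_betw_same_card[OF bij_betw_lat, symmetric])
  also have "\<dots> = card ({..d} \<rightarrow>\<^sub>E {0..k}) - card ({..d} \<rightarrow>\<^sub>E {1..k})"
    by (intro card_Diff_subset finite_PiE PiE_mono) auto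
  finally show ?thesis by (simp add: card_PiE)
qed

text \<open>The lattice points whose gauge is exactly \<open>k\<close>.\<close>

definition layer :: "nat \<Rightarrow> nat \<Rightarrow> rvec set" where
  "layer d k = lat d k - (\<Union>j<k. lat d j)"

lemma layer_0: "layer d 0 = lat d 0"
  by (simp add: layer_def)

lemma layer_Suc: "layer d (Suc k) = lat d (Suc k) - lat d k"
proof -
  have "(\<Union>j<Suc k. lat d j) = lat d k"
    using lat_mono[of _ k d] by (force simp: less_Suc_eq_le)
  then show ?thesis by (simp only: layer_def)
qed

lemma disjoint_layer: "i \<noteq> j \<Longrightarrow> layer d i \<inter> layer d j = {}"
  unfolding layer_def by (cases i j rule: linorder_cases) auto

lemma finite_layer: "finite (layer d k)"
  by (simp add: layer_def finite_lat)

definition lat_pairs :: "nat \<Rightarrow> nat \<Rightarrow> nat \<Rightarrow> (rvec \<times> rvec) set" where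
  "lat_pairs m n k = {(x, y). \<exists>a b. a + b \<le> k \<and> x \<in> lat m a \<and> y \<in> lat n b}"

text \<open>Choosing the least possible \<open>b\<close> for \<open>y\<close> makes the union
  disjoint, which turns the count into a convolution.\<close>

lemma lat_pairs_eq: "lat_pairs m n k = (\<Union>b\<le>k. lat m (k - b) \<times> layer n b)"
proof (intro equalityI subsetI)
  fix z assume "z \<in> lat_pairs m n k"
  then obtain x y a b where z: "z = (x, y)" "a + b \<le> k" "x \<in> lat m a" "y \<in> lat n b"
    unfolding lat_pairs_def by blast
  define b' where "b' = (LEAST b. y \<in> lat n b)"
  have b': "y \<in> lat n b'" "b' \<le> b"
    unfolding b'_def using z(4) by (rule LeastI, rule Least_le)
  have "y \<in> layer n b'"
    using b'(1) not_less_Least unfolding layer_def b'_def by blast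
  moreover have "x \<in> lat m (k - b')" by (rule subsetD[OF lat_mono z(3)]) (use z(2) b'(2) in linarith)
  ultimately show "z \<in> (\<Union>b\<le>k. lat m (k - b) \<times> layer n b)" using z b' by auto
next
  fix z assume "z \<in> (\<Union>b\<le>k. lat m (k - b) \<times> layer n b)"
  then obtain x y b where "b \<le> k" "z = (x, y)" "x \<in> lat m (k - b)" "y \<in> lat n b"
    by (auto simp: layer_def)
  moreover from this have "(k - b) + b \<le> k" by simp
  ultimately show "z \<in> lat_pairs m n k" unfolding lat_pairs_def by blast
qed

lemma card_lat_pairs_commute: "card (lat_pairs m n k) = card (lat_pairs n m k)"
proof -
  have sub: "prod.swap ` lat_pairs m n k \<subseteq> lat_pairs n m k" for m n
    unfolding lat_pairs_def by clarsimp (metis add.commute)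
  have "lat_pairs n m k = prod.swap ` prod.swap ` lat_pairs n m k" by (simp add: image_image)
  also have "\<dots> \<subseteq> prod.swap ` lat_pairs m n k" by (intro image_mono sub)
  finally have "lat_pairs n m k = prod.swap ` lat_pairs m n k" using sub by blast
  then show ?thesis by (simp add: card_image)
qed

lemma slab_sum_Zn: "slab_sum m n (real k) \<inter> Zn (m + n) = (\<lambda>(x, y). vpair m x y) ` lat_pairs m n k"
proof (intro equalityI subsetI)
  fix z assume z: "z \<in> slab_sum m n (real k) \<inter> Zn (m + n)"
  then obtain x y a b where *: "z = vpair m x y" "x \<in> slab m a" "y \<in> slab n b" "a + b \<le> real k"
    unfolding slab_sum_def by blast
  with z have Zn: "x \<in> Zn m" "y \<in> Zn n" by (auto simp: Zn_vpair_iff slab_in_Rn)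
  have "real (nat \<lfloor>a\<rfloor>) \<le> a" "real (nat \<lfloor>b\<rfloor>) \<le> b"
    using slab_nonneg *(2,3) by (auto simp: of_nat_floor)
  then have "nat \<lfloor>a\<rfloor> + nat \<lfloor>b\<rfloor> \<le> k" using *(4) by linarith
  then have "(x, y) \<in> lat_pairs m n k"
    unfolding lat_pairs_def using lat_nat_floor * Zn by blast
  then show "z \<in> (\<lambda>(x, y). vpair m x y) ` lat_pairs m n k" using *(1) by force
next
  fix z assume "z \<in> (\<lambda>(x, y). vpair m x y) ` lat_pairs m n k"
  then obtain x y a b where "z = vpair m x y" "a + b \<le> k" "x \<in> lat m a" "y \<in> lat n b"
    unfolding lat_pairs_def by auto
  then show "z \<in> slab_sum m n (real k) \<inter> Zn (m + n)"
    by (auto simp: lat_def Zn_vpair_iff slab_in_Rn intro!: slab_sumI[of _ _ "real a" _ _ "real b"])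
qed

lemma card_slab_sum_Zn: "card (slab_sum m n (real k) \<inter> Zn (m + n)) = card (lat_pairs m n k)"
proof -
  have "inj_on (\<lambda>(x, y). vpair m x y) (lat_pairs m n k)"
  proof (rule inj_onI, clarify)
    fix x y x' y' assume "(x, y) \<in> lat_pairs m n k" "(x', y') \<in> lat_pairs m n k" "vpair m x y = vpair m x' y'"
    then show "x = x' \<and> y = y'"
      by (intro vpair_inject[of x m x' y n y']) (auto simp: lat_pairs_def lat_def slab_in_Rn)
  qed
  then show ?thesis by (simp add: slab_sum_Zn card_image)
qed

definition lat_count :: "nat \<Rightarrow> real \<Rightarrow> real" where
  "lat_count d x = (x + 1) ^ (d + 1) - x ^ (d + 1)"

text \<open>This counts \<open>layer d k\<close> only for \<open>k \<ge> 1\<close>; \<open>layer d 0\<close> is the origin.\<close>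

definition layer_count :: "nat \<Rightarrow> real \<Rightarrow> real" where
  "layer_count d x = (x + 1) ^ (d + 1) - 2 * x ^ (d + 1) + (x - 1) ^ (d + 1)"

lemma real_card_lat: "real (card (lat d k)) = lat_count d (real k)"
proof -
  have "k ^ (d + 1) \<le> (k + 1) ^ (d + 1)" by (intro power_mono) auto
  then show ?thesis by (simp only: card_lat lat_count_def of_nat_diff) (simp add: algebra_simps)
qed

lemma real_card_layer_Suc: "real (card (layer d (Suc k))) = layer_count d (real (Suc k))"
proof -
  have "card (lat d k) \<le> card (lat d (Suc k))" by (intro card_mono finite_lat lat_mono) simp
  then have "real (card (layer d (Suc k))) = real (card (lat d (Suc k))) - real (card (lat d k))"
    unfolding layer_Suc by (simp add: card_Diff_subset finite_lat lat_mono of_nat_diff)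
  then show ?thesis unfolding real_card_lat by (simp add: lat_count_def layer_count_def add.commute)
qed

lemma card_lat_pairs:
  "real (card (lat_pairs m n k)) = lat_count m (real k) + (\<Sum>i<k. lat_count m (real i) * layer_count n (real k - real i))"
proof -
  have "card (lat_pairs m n k) = (\<Sum>b\<le>k. card (lat m (k - b) \<times> layer n b))"
    unfolding lat_pairs_eq
    by (intro card_UN_disjoint) (simp_all add: finite_lat finite_layer Times_Int_Times disjoint_layer)
  then have "real (card (lat_pairs m n k)) = (\<Sum>b\<le>k. lat_count m (real (k - b)) * real (card (layer n b)))"
    by (simp add: card_cartesian_product real_card_lat)
  \<comment> \<open>The term \<open>b = 0\<close> is split off because \<open>layer n 0\<close> has
    one element, whereas \<open>layer_count n 0\<close> is 0 or 2.\<close>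
  also have "\<dots> = lat_count m (real k) + (\<Sum>b<k. lat_count m (real (k - Suc b)) * real (card (layer n (Suc b))))"
    by (subst sum.atMost_shift) (simp add: layer_0 card_lat)
  also have "(\<Sum>b<k. lat_count m (real (k - Suc b)) * real (card (layer n (Suc b))))
      = (\<Sum>i<k. lat_count m (real i) * layer_count n (real k - real i))"
    by (subst sum.nat_diff_reindex[symmetric], intro sum.cong)
      (auto simp: real_card_layer_Suc of_nat_diff)
  finally show ?thesis .
qed

section \<open>The CL property in terms of counts, and the cases with a summand of dimension at most
  1\<close>

lemma CL_free_sum_A_dualI:
  assumes "\<And>k. poly p (of_nat k) = of_nat (card (lat_pairs m n k))"
    and "\<And>z. poly p z = 0 \<Longrightarrow> Re z = - 1 / 2"
  shows "CL_polytope (m + n) (free_sum m (A_dual m) (A_dual n))"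
  unfolding CL_polytope_def
proof (intro conjI exI[of _ p] allI impI)
  show "is_ehrhart_poly (m + n) (free_sum m (A_dual m) (A_dual n)) p"
    unfolding is_ehrhart_poly_def A_dual_eq_slab free_sum_slab scaleR_slab_sum card_slab_sum_Zn
    using assms(1) by blast
qed (use assms(2) reflexive_free_sum_A_dual in auto)

text \<open>Unlike the free sum itself, this numerical form is visibly symmetric in \<open>m\<close>
  and \<open>n\<close>.\<close>

definition CL_pair :: "nat \<Rightarrow> nat \<Rightarrow> bool" where
  "CL_pair m n \<longleftrightarrow> (\<exists>p. (\<forall>k. poly p (of_nat k) = (of_nat (card (lat_pairs m n k)) :: complex)) \<and>
     (\<forall>z. poly p z = 0 \<longrightarrow> Re z = - 1 / 2))"

lemma CL_pair_commute: "CL_pair m n = CL_pair n m"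
  by (simp add: CL_pair_def card_lat_pairs_commute[of m n])

text \<open>The critical line is the perpendicular bisector of -1 and 0.\<close>

lemma norm_eq_imp_Re: "cmod (z + 1) = cmod z \<Longrightarrow> Re z = - 1 / 2"
proof -
  assume "cmod (z + 1) = cmod z"
  then have "(cmod (z + 1))\<^sup>2 = (cmod z)\<^sup>2" by simp
  then show ?thesis unfolding cmod_power2 by (simp add: power2_eq_square algebra_simps)
qed

lemma Re_if_power_eq:
  assumes "cmod ((z + 1) ^ Suc m) = cmod (z ^ Suc m)"
  shows "Re z = - 1 / 2"
proof -
  have "cmod (z + 1) ^ Suc m = cmod z ^ Suc m"
    using assms by (simp only: norm_power)
  then have "cmod (z + 1) = cmod z"
    by (rule power_inject_base) auto
  then show ?thesis by (rule norm_eq_imp_Re)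
qed

lemma CL_pair_0: "CL_pair m 0"
  unfolding CL_pair_def
proof (intro exI conjI allI impI)
  let ?p = "[:1, 1:] ^ Suc m - [:0, 1:] ^ Suc m :: complex poly"
  fix k :: nat
  \<comment> \<open>The second difference \<open>layer_count 0\<close> of a linear function
    vanishes, so only the first term of the convolution survives.\<close>
  have "real (card (lat_pairs m 0 k)) = (real k + 1) ^ Suc m - real k ^ Suc m"
    by (simp add: card_lat_pairs layer_count_def lat_count_def)
  then have "complex_of_real (real (card (lat_pairs m 0 k))) = complex_of_real ((real k + 1) ^ Suc m - real k ^ Suc m)"
    by simp
  then show "poly ?p (of_nat k) = of_nat (card (lat_pairs m 0 k))" by (simp add: algebra_simps)
next
  let ?p = "[:1, 1:] ^ Suc m - [:0, 1:] ^ Suc m :: complex poly"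
  fix z assume "poly ?p z = 0"
  then have "(z + 1) ^ Suc m = z ^ Suc m" by (simp only: poly_diff poly_power) (simp add: add.commute)
  then show "Re z = - 1 / 2" by (intro Re_if_power_eq[of z m]) simp
qed

lemma CL_pair_1: "CL_pair m 1"
  unfolding CL_pair_def
proof (intro exI conjI allI impI)
  let ?p = "[:1, 1:] ^ Suc m + [:0, 1:] ^ Suc m :: complex poly"
  fix k :: nat
  \<comment> \<open>The second polytope is the interval from -1 to 1, each of whose layers beyond
    the origin has two points; the remaining sum telescopes.\<close>
  have "layer_count 1 x = 2" for x by (simp add: layer_count_def power2_eq_square algebra_simps)
  moreover have "(\<Sum>i<k. lat_count m (real i)) = real k ^ Suc m"
    by (induction k) (simp_all add: lat_count_def algebra_simps)
  ultimately have "real (card (lat_pairs m 1 k)) = lat_count m (real k) + real k ^ Suc m * 2"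
    by (simp only: card_lat_pairs sum_distrib_right[symmetric])
  then have "real (card (lat_pairs m 1 k)) = (real k + 1) ^ Suc m + real k ^ Suc m"
    by (simp add: lat_count_def)
  then have "complex_of_real (real (card (lat_pairs m 1 k))) = complex_of_real ((real k + 1) ^ Suc m + real k ^ Suc m)"
    by simp
  then show "poly ?p (of_nat k) = of_nat (card (lat_pairs m 1 k))" by (simp add: algebra_simps)
next
  let ?p = "[:1, 1:] ^ Suc m + [:0, 1:] ^ Suc m :: complex poly"
  fix z assume "poly ?p z = 0"
  then have "(z + 1) ^ Suc m + z ^ Suc m = 0" by (simp only: poly_add poly_power) (simp add: add.commute)
  then have "(z + 1) ^ Suc m = - (z ^ Suc m)" by (simp only: eq_neg_iff_add_eq_0)
  then show "Re z = - 1 / 2" by (intro Re_if_power_eq[of z m]) simp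
qed

subsection \<open>Roots of the Ehrhart polynomials\<close>

lemma map_poly_of_real_of_real: "poly (map_poly of_real p) (of_real x :: complex) = of_real (poly p x)"
  by (induction p) (simp_all add: map_poly_pCons)

text \<open>As many distinct real roots as the degree leave no room for a further complex
  root.\<close>

lemma complex_roots_of_real_rooted:
  fixes p :: "real poly"
  assumes S: "finite S" "card S = degree p" "\<And>s. s \<in> S \<Longrightarrow> poly p s = 0"
    and p: "p \<noteq> 0" and z: "poly (map_poly of_real p) (z::complex) = 0"
  shows "z \<in> of_real ` S"
proof (rule ccontr)
  let ?R = "{z. poly (map_poly of_real p) z = (0::complex)}"
  assume "z \<notin> of_real ` S"
  then have "card (insert z (of_real ` S)) = Suc (degree p)"
    using S by (simp add: card_image inj_on_def)
  moreover have ne: "map_poly of_real p \<noteq> (0 :: complex poly)"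
    using p by (simp add: map_poly_eq_0_iff)
  moreover have "insert z (of_real ` S) \<subseteq> ?R"
    using z S(3) by (auto simp: map_poly_of_real_of_real)
  then have "card (insert z (of_real ` S)) \<le> card ?R"
    using ne by (intro card_mono poly_roots_finite)
  ultimately show False
    using card_poly_roots_bound[OF ne] by (simp add: degree_map_poly)
qed

text \<open>At a root, \<open>u = z + 1 / 2\<close> is zero or has a negative real square, hence is
  purely imaginary. The exponent \<open>e\<close> serves for the factor \<open>u\<close> in odd
  dimension.\<close>

lemma CL_pair_if_neg_roots:
  fixes r :: "real poly"
  assumes S: "finite S" "card S = degree r" "\<And>s. s \<in> S \<Longrightarrow> poly r s = 0 \<and> s < 0" and r: "r \<noteq> 0"
    and count: "\<And>k. real (card (lat_pairs m n k)) = (real k + 1 / 2) ^ e * poly r ((real k + 1 / 2)\<^sup>2)"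
  shows "CL_pair m n"
  unfolding CL_pair_def
proof (intro exI conjI allI impI)
  let ?p = "[:1 / 2, 1:] ^ e * pcompose (map_poly of_real r) ([:1 / 2, 1:]\<^sup>2) :: complex poly"
  have p: "poly ?p z = (z + 1 / 2) ^ e * poly (map_poly of_real r) ((z + 1 / 2)\<^sup>2)" for z
    by (simp add: poly_pcompose add.commute)
  show "poly ?p (of_nat k) = of_nat (card (lat_pairs m n k))" for k
  proof -
    have "complex_of_nat k + 1 / 2 = of_real (real k + 1 / 2)" by simp
    then have "poly ?p (of_nat k) = of_real ((real k + 1 / 2) ^ e * poly r ((real k + 1 / 2)\<^sup>2))"
      unfolding p by (simp only: of_real_mult of_real_power map_poly_of_real_of_real[symmetric])
    then show ?thesis by (simp only: count[symmetric] of_real_of_nat_eq)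
  qed
  fix z assume "poly ?p z = 0"
  then have "(z + 1 / 2) ^ e * poly (map_poly of_real r) ((z + 1 / 2)\<^sup>2) = 0"
    unfolding p .
  then consider "z + 1 / 2 = 0" | "poly (map_poly of_real r) ((z + 1 / 2)\<^sup>2) = 0"
    by (metis mult_eq_0_iff power_not_zero)
  then show "Re z = - 1 / 2"
  proof cases
    case 1
    then show ?thesis by (simp add: complex_eq_iff)
  next
    case 2
    then obtain s where s: "s \<in> S" "(z + 1 / 2)\<^sup>2 = of_real s"
      using complex_roots_of_real_rooted[of S r "(z + 1 / 2)\<^sup>2"] S r by blast
    define u where "u = z + 1 / 2"
    have "(Re u)\<^sup>2 - (Im u)\<^sup>2 = s" "Re u * Im u = 0"
      using s(2) by (auto simp: u_def complex_eq_iff power2_eq_square)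
    \<comment> \<open>Otherwise \<open>Im u = 0\<close>, and \<open>s\<close> would be a square of a
      real number.\<close>
    then have "Re u = 0" using S(3)[OF s(1)] by (auto simp: not_less[symmetric])
    then show ?thesis by (simp add: u_def)
  qed
qed

text \<open>The intermediate value theorem puts a root into each of \<open>degree r\<close>
  consecutive open intervals. Disjointness makes these roots distinct, and the last endpoint makes
  them negative.\<close>

lemma CL_pair_if_sign_changes:
  fixes r :: "real poly" and x :: "nat \<Rightarrow> real"
  assumes x: "\<forall>i<degree r. x i < x (Suc i) \<and> poly r (x i) * poly r (x (Suc i)) < 0"
    and x0: "x (degree r) \<le> 0" and r: "r \<noteq> 0"
    and count: "\<And>k. real (card (lat_pairs m n k)) = (real k + 1 / 2) ^ e * poly r ((real k + 1 / 2)\<^sup>2)"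
  shows "CL_pair m n"
proof -
  have "\<forall>i<degree r. \<exists>s. x i < s \<and> s < x (Suc i) \<and> poly r s = 0"
    using x poly_IVT by blast
  then obtain s where s: "\<And>i. i < degree r \<Longrightarrow> x i < s i \<and> s i < x (Suc i) \<and> poly r (s i) = 0"
    by metis
  have mono: "x i \<le> x j" if "i \<le> j" "j \<le> degree r" for i j
    using that
  proof (induction rule: dec_induct)
    case (step n)
    then have "x i \<le> x n" "x n < x (Suc n)" using x by auto
    then show ?case by simp
  qed simp
  have less: "s i < s j" if "i < j" "j < degree r" for i j
    using s[of i] s[of j] mono[of "Suc i" j] that by simp
  then have "inj_on s {..<degree r}"
    by (intro linorder_inj_onI) (auto simp: less_imp_neq)
  moreover have "s i < 0" if "i < degree r" for i
    using s[of i] mono[of "Suc i" "degree r"] x0 that by simp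
  ultimately show ?thesis
    using s r count by (intro CL_pair_if_neg_roots[of "s ` {..<degree r}" r m n e]) (auto simp: card_image)
qed

text \<open>In the following sums, \<open>c\<close> stands for \<open>k\<close> but stays fixed in the induction on \<open>k\<close>.\<close>

lemma CL_pair_2_2: "CL_pair 2 2"
\<comment> \<open>Here \<open>r\<close> is the Ehrhart polynomial rewritten in the square of
  \<open>z + 1 / 2\<close>, and the list \<open>x\<close> gives points at which \<open>r\<close>
  alternates in sign.\<close>
proof (rule CL_pair_if_sign_changes[where e = 0 and r = "[:11 / 32, 9 / 4, 3 / 2:]" and x = "(!) [-2, -1, 0]"])
  fix k
  have sums: "(\<Sum>i<k. lat_count 2 (real i) * layer_count 2 (c - real i)) =
      (3 / 2) * real k ^ 2 + 3 * real k ^ 3 + 6 * real k ^ 3 * c - (9 / 2) * real k ^ 4" for c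
    by (induction k) (simp_all add: lat_count_def layer_count_def field_simps power_numeral_reduce)
  show "real (card (lat_pairs 2 2 k)) = (real k + 1 / 2) ^ 0 * poly [:11 / 32, 9 / 4, 3 / 2:] ((real k + 1 / 2)\<^sup>2)"
    unfolding card_lat_pairs sums by (simp add: lat_count_def field_simps power_numeral_reduce)
qed (simp_all add: numeral_eq_Suc All_less_Suc)

lemma CL_pair_3_2: "CL_pair 3 2"
proof (rule CL_pair_if_sign_changes[where e = 1 and r = "[:47 / 40, 3, 6 / 5:]" and x = "(!) [-3, -1, 0]"])
  fix k
  have sums: "(\<Sum>i<k. lat_count 3 (real i) * layer_count 2 (c - real i)) =
      - (1 / 5) * real k + 2 * real k ^ 3 + 3 * real k ^ 4 + 6 * real k ^ 4 * c - (24 / 5) * real k ^ 5" for c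
    by (induction k) (simp_all add: lat_count_def layer_count_def field_simps power_numeral_reduce)
  show "real (card (lat_pairs 3 2 k)) = (real k + 1 / 2) ^ 1 * poly [:47 / 40, 3, 6 / 5:] ((real k + 1 / 2)\<^sup>2)"
    unfolding card_lat_pairs sums by (simp add: lat_count_def field_simps power_numeral_reduce)
qed (simp_all add: numeral_eq_Suc All_less_Suc)

lemma CL_pair_4_2: "CL_pair 4 2"
\<comment> \<open>The constant term is positive but only \<open>1 / 64\<close>, so the largest root
  lies just below the endpoint 0.\<close>
proof (rule CL_pair_if_sign_changes[where e = 0 and r = "[:1 / 64, 47 / 16, 15 / 4, 1:]" and x = "(!) [-3, -2, -1, 0]"])
  fix k
  have sums: "(\<Sum>i<k. lat_count 4 (real i) * layer_count 2 (c - real i)) =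
      - (1 / 2) * real k ^ 2 + (5 / 2) * real k ^ 4 + 3 * real k ^ 5 + 6 * real k ^ 5 * c - 5 * real k ^ 6" for c
    by (induction k) (simp_all add: lat_count_def layer_count_def field_simps power_numeral_reduce)
  show "real (card (lat_pairs 4 2 k)) = (real k + 1 / 2) ^ 0 * poly [:1 / 64, 47 / 16, 15 / 4, 1:] ((real k + 1 / 2)\<^sup>2)"
    unfolding card_lat_pairs sums by (simp add: lat_count_def field_simps power_numeral_reduce)
qed (simp_all add: numeral_eq_Suc All_less_Suc)

lemma CL_pair_5_2: "CL_pair 5 2"
\<comment> \<open>The point \<open>-5 / 2\<close> is chosen because \<open>r\<close> is negative at
  both -3 and -2.\<close>
proof (rule CL_pair_if_sign_changes[where e = 1 and r = "[:53 / 224, 47 / 8, 9 / 2, 6 / 7:]" and x = "(!) [-3, -5 / 2, -1 / 2, 0]"])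
  fix k
  have sums: "(\<Sum>i<k. lat_count 5 (real i) * layer_count 2 (c - real i)) =
      (1 / 7) * real k - 1 * real k ^ 3 + 3 * real k ^ 5 + 3 * real k ^ 6 + 6 * real k ^ 6 * c - (36 / 7) * real k ^ 7" for c
    by (induction k) (simp_all add: lat_count_def layer_count_def field_simps power_numeral_reduce)
  show "real (card (lat_pairs 5 2 k)) = (real k + 1 / 2) ^ 1 * poly [:53 / 224, 47 / 8, 9 / 2, 6 / 7:] ((real k + 1 / 2)\<^sup>2)"
    unfolding card_lat_pairs sums by (simp add: lat_count_def field_simps power_numeral_reduce)
qed (simp_all add: numeral_eq_Suc All_less_Suc)

lemma CL_pair_3_3: "CL_pair 3 3"
\<comment> \<open>At \<open>-1 / 2\<close>, between the two largest roots, \<open>r\<close> is only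
  \<open>-1 / 80\<close>.\<close>
proof (rule CL_pair_if_sign_changes[where e = 0 and r = "[:5 / 16, 39 / 20, 3, 4 / 5:]" and x = "(!) [-3, -1, -1 / 2, 0]"])
  fix k
  have sums: "(\<Sum>i<k. lat_count 3 (real i) * layer_count 3 (c - real i)) =
      - (2 / 5) * real k - (4 / 5) * real k * c + 2 * real k ^ 2 + 4 * real k ^ 3 + 8 * real k ^ 3 * c - 2 * real k ^ 4 + 12 * real k ^ 4 * c + 12 * real k ^ 4 * c ^ 2 - (48 / 5) * real k ^ 5 - (96 / 5) * real k ^ 5 * c + 8 * real k ^ 6" for c
    by (induction k) (simp_all add: lat_count_def layer_count_def field_simps power_numeral_reduce)
  show "real (card (lat_pairs 3 3 k)) = (real k + 1 / 2) ^ 0 * poly [:5 / 16, 39 / 20, 3, 4 / 5:] ((real k + 1 / 2)\<^sup>2)"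
    unfolding card_lat_pairs sums by (simp add: lat_count_def field_simps power_numeral_reduce)
qed (simp_all add: numeral_eq_Suc All_less_Suc)

lemma CL_pair_4_3: "CL_pair 4 3"
\<comment> \<open>The point \<open>-2 / 3\<close> separates two close roots: \<open>r\<close> is
  positive at both -1 and \<open>-1 / 2\<close>.\<close>
proof (rule CL_pair_if_sign_changes[where e = 1 and r = "[:111 / 112, 13 / 4, 3, 4 / 7:]" and x = "(!) [-4, -1, -2 / 3, 0]"])
  fix k
  have sums: "(\<Sum>i<k. lat_count 4 (real i) * layer_count 3 (c - real i)) =
      - (4 / 7) * real k - 1 * real k ^ 2 - 2 * real k ^ 2 * c + 4 * real k ^ 3 + 5 * real k ^ 4 + 10 * real k ^ 4 * c - 4 * real k ^ 5 + 12 * real k ^ 5 * c + 12 * real k ^ 5 * c ^ 2 - 10 * real k ^ 6 - 20 * real k ^ 6 * c + (60 / 7) * real k ^ 7" for c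
    by (induction k) (simp_all add: lat_count_def layer_count_def field_simps power_numeral_reduce)
  show "real (card (lat_pairs 4 3 k)) = (real k + 1 / 2) ^ 1 * poly [:111 / 112, 13 / 4, 3, 4 / 7:] ((real k + 1 / 2)\<^sup>2)"
    unfolding card_lat_pairs sums by (simp add: lat_count_def field_simps power_numeral_reduce)
qed (simp_all add: numeral_eq_Suc All_less_Suc)

theorem theorem1:
  fixes m n :: nat
  assumes "min m n \<le> 1 \<or> m + n \<le> 7"
  shows "CL_polytope (m + n) (free_sum m (A_dual m) (A_dual n))"
proof -
  \<comment> \<open>By symmetry the smaller dimension may come second; \<open>b\<close> \<ge> 2 then
    leaves six pairs.\<close>
  have small: "CL_pair a b" if "b \<le> a" "b \<le> 1 \<or> a + b \<le> 7" for a b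
  proof -
    have "b = 0 \<or> b = 1 \<or> (b = 2 \<and> a \<in> {2, 3, 4, 5}) \<or> (b = 3 \<and> a \<in> {3, 4})"
      using that by auto
    then show ?thesis
      using CL_pair_0 CL_pair_1 CL_pair_2_2 CL_pair_3_2 CL_pair_4_2 CL_pair_5_2 CL_pair_3_3 CL_pair_4_3
      by auto
  qed
  have "CL_pair m n"
  proof (cases "n \<le> m")
    case True
    then show ?thesis using small[of n m] assms by (simp add: min_def split: if_splits)
  next
    case False
    then show ?thesis
      unfolding CL_pair_commute[of m n] using small[of m n] assms by (simp add: min_def add.commute)
  qed
  then show ?thesis unfolding CL_pair_def using CL_free_sum_A_dualI by blast
qed

end
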